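(* Let $(Q,\cdot)$ be a quasigroup, and let $\alpha,\beta:Q\to Q$ be the maps determined by $x\,\alpha(x)=x=\beta(x)\,x$ for all $x\in Q$. Then $Q$ is an FG-quasigroup if and only if both of the identities $$xy\cdot\alpha(u)v = x\alpha(u)\cdot yv \qquad (A)$$ $$xy\cdot\beta(u)v = x\beta(u)\cdot yv \qquad (B)$$ hold for all $x,y,u,v\in Q$.
   Context: A quasigroup is a non-empty set $Q$ with a binary operation (written multiplicatively) such that all left translations $L_a:x\mapsto ax$ and all right translations $R_a:x\mapsto xa$ are permutations of $Q$. Juxtaposition binds more tightly than $\cdot$, so for example $xy\cdot zw$ means $(xy)(zw)$ and $xy\cdot \alpha(u)v$ means $(xy)(\alpha(u)v)$. In a quasigroup the maps $\alpha,\beta:Q\to Q$ are defined by $x\,\alpha(x)=x=\beta(x)\,x$. $Q$ is a left F-quasigroup if $x\cdot yz = xy\cdot\alpha(x)z$ for all $x,y,z\in Q$; a right F-quasigroup if $zy\cdot x = z\beta(x)\cdot yx$ for all $x,y,z\in Q$; an F-quasigroup if it is both. A quasigroup $(Q,\cdot)$ is isotopic to a group $(G,+)$ if there are bijections $a,b,c:Q\to G$ with $c(xy)=a(x)+b(y)$ for all $x,y\in Q$. An FG-quasigroup is an F-quasigroup isotopic to a (possibly noncommutative) group. *)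

theory Defs
  imports "HOL-Algebra.Group"
begin

locale quasigroup =
  fixes Q :: "'a set" and mult :: "'a \<Rightarrow> 'a \<Rightarrow> 'a" (infixl "\<cdot>" 70)
  assumes nonempty: "Q \<noteq> {}"
    and left_translation: "a \<in> Q \<Longrightarrow> bij_betw (\<lambda>x. a \<cdot> x) Q Q"
    and right_translation: "a \<in> Q \<Longrightarrow> bij_betw (\<lambda>x. x \<cdot> a) Q Q"

context
  fixes Q :: "'a set" and mult :: "'a \<Rightarrow> 'a \<Rightarrow> 'a" (infixl "\<cdot>" 70)
begin

text \<open>For \<open>x \<in> Q\<close> in a quasigroup both definite descriptions denote, see the lemmas \<open>right_unit\<close> and
  \<open>left_unit\<close> below; they are unspecified otherwise.\<close>

definition right_unit :: "'a \<Rightarrow> 'a"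
  where "right_unit x = (THE e. e \<in> Q \<and> x \<cdot> e = x)"

definition left_unit :: "'a \<Rightarrow> 'a"
  where "left_unit x = (THE e. e \<in> Q \<and> e \<cdot> x = x)"

definition left_F_quasigroup :: bool
  where "left_F_quasigroup \<longleftrightarrow> quasigroup Q (\<cdot>) \<and>
    (\<forall>x\<in>Q. \<forall>y\<in>Q. \<forall>z\<in>Q. x \<cdot> (y \<cdot> z) = (x \<cdot> y) \<cdot> (right_unit x \<cdot> z))"

definition right_F_quasigroup :: bool
  where "right_F_quasigroup \<longleftrightarrow> quasigroup Q (\<cdot>) \<and>
    (\<forall>x\<in>Q. \<forall>y\<in>Q. \<forall>z\<in>Q. (z \<cdot> y) \<cdot> x = (z \<cdot> left_unit x) \<cdot> (y \<cdot> x))"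

definition F_quasigroup :: bool
  where "F_quasigroup \<longleftrightarrow> left_F_quasigroup \<and> right_F_quasigroup"

definition isotopic_to :: "('b, 'c) monoid_scheme \<Rightarrow> bool"
  where "isotopic_to G \<longleftrightarrow> (\<exists>a b c.
    bij_betw a Q (carrier G) \<and> bij_betw b Q (carrier G) \<and> bij_betw c Q (carrier G) \<and>
    (\<forall>x\<in>Q. \<forall>y\<in>Q. c (x \<cdot> y) = a x \<otimes>\<^bsub>G\<^esub> b y))"

text \<open>The group is sought among groups with elements of type \<^typ>\<open>'a\<close>. This is no restriction:
  lemma \<open>isotopic_to_any_group\<close> transports a group over any other type to the carrier \<open>Q\<close>.\<close>

definition isotopic_to_group :: bool
  where "isotopic_to_group \<longleftrightarrow> (\<exists>G :: 'a monoid. group G \<and> isotopic_to G)"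

definition FG_quasigroup :: bool
  where "FG_quasigroup \<longleftrightarrow> F_quasigroup \<and> isotopic_to_group"

end

context quasigroup
begin

lemma right_unit:
  assumes "x \<in> Q"
  shows "right_unit Q (\<cdot>) x \<in> Q" "x \<cdot> right_unit Q (\<cdot>) x = x"
proof -
  have "\<exists>!e. e \<in> Q \<and> x \<cdot> e = x"
    using left_translation[OF assms] assms
    unfolding bij_betw_def inj_on_def by (metis (no_types, lifting) imageE)
  from theI'[OF this]
  show "right_unit Q (\<cdot>) x \<in> Q" "x \<cdot> right_unit Q (\<cdot>) x = x"
    by (auto simp: right_unit_def)
qed

lemma left_unit:
  assumes "x \<in> Q"
  shows "left_unit Q (\<cdot>) x \<in> Q" "left_unit Q (\<cdot>) x \<cdot> x = x"
proof -
  have "\<exists>!e. e \<in> Q \<and> e \<cdot> x = x"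
    using right_translation[OF assms] assms
    unfolding bij_betw_def inj_on_def by (metis (no_types, lifting) imageE)
  from theI'[OF this]
  show "left_unit Q (\<cdot>) x \<in> Q" "left_unit Q (\<cdot>) x \<cdot> x = x"
    by (auto simp: left_unit_def)
qed

end

lemma isotopic_to_any_group:
  fixes Q :: "'a set" and mult :: "'a \<Rightarrow> 'a \<Rightarrow> 'a" and G :: "('b, 'c) monoid_scheme"
  assumes "group G" "isotopic_to Q mult G"
  shows "isotopic_to_group Q mult"
proof -
  interpret G: group G by fact
  obtain a b c where a: "bij_betw a Q (carrier G)" and b: "bij_betw b Q (carrier G)"
    and c: "bij_betw c Q (carrier G)"
    and eq: "\<forall>x\<in>Q. \<forall>y\<in>Q. c (mult x y) = a x \<otimes>\<^bsub>G\<^esub> b y"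
    using assms(2) by (auto simp: isotopic_to_def)
  define d where "d = inv_into Q c"
  have d: "bij_betw d (carrier G) Q"
    unfolding d_def by (rule bij_betw_inv_into[OF c])
  have cd: "c (d g) = g" if "g \<in> carrier G" for g
    unfolding d_def using c that by (simp add: bij_betw_inv_into_right)
  have dc: "d (c x) = x" if "x \<in> Q" for x
    unfolding d_def using c that by (simp add: bij_betw_inv_into_left)
  have cQ: "c x \<in> carrier G" if "x \<in> Q" for x using c that by (auto simp: bij_betw_def)
  have dG: "d g \<in> Q" if "g \<in> carrier G" for g using d that by (auto simp: bij_betw_def)
  have aQ: "a x \<in> carrier G" if "x \<in> Q" for x using a that by (auto simp: bij_betw_def)
  have bQ: "b x \<in> carrier G" if "x \<in> Q" for x using b that by (auto simp: bij_betw_def)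
  define H :: "'a monoid" where
    "H = \<lparr>carrier = Q, monoid.mult = (\<lambda>x y. d (c x \<otimes>\<^bsub>G\<^esub> c y)), one = d \<one>\<^bsub>G\<^esub>\<rparr>"
  have "group H"
  proof (rule groupI)
    fix x assume x: "x \<in> carrier H"
    then have "d (inv\<^bsub>G\<^esub> (c x)) \<otimes>\<^bsub>H\<^esub> x = \<one>\<^bsub>H\<^esub>"
      by (simp add: H_def cd cQ)
    moreover have "d (inv\<^bsub>G\<^esub> (c x)) \<in> carrier H" using x by (simp add: H_def dG cQ)
    ultimately show "\<exists>y\<in>carrier H. y \<otimes>\<^bsub>H\<^esub> x = \<one>\<^bsub>H\<^esub>" by blast
  qed (auto simp: H_def dG cQ cd dc G.m_assoc)
  moreover have "isotopic_to Q mult H"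
    unfolding isotopic_to_def
  proof (intro exI conjI ballI)
    show "bij_betw (d \<circ> a) Q (carrier H)" "bij_betw (d \<circ> b) Q (carrier H)"
      "bij_betw (d \<circ> c) Q (carrier H)"
      using bij_betw_trans[OF a d] bij_betw_trans[OF b d] bij_betw_trans[OF c d]
      by (simp_all add: H_def)
    fix x y assume "x \<in> Q" "y \<in> Q"
    then show "(d \<circ> c) (mult x y) = (d \<circ> a) x \<otimes>\<^bsub>H\<^esub> (d \<circ> b) y"
      using eq by (simp add: H_def cd aQ bQ)
  qed
  ultimately show ?thesis by (auto simp: isotopic_to_group_def)
qed

end

theory Submission
  imports Defs
begin

text \<open>
  The proof passes through a normal form: both sides of the equivalence imply that \<open>Q\<close> carries a
  group structure for which \<open>x \<cdot> y = f x \<otimes> a \<otimes> g y\<close> with automorphisms \<open>f\<close>, \<open>g\<close> and a constant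
  \<open>a\<close> (locale \<open>affine_quasigroup\<close>). Over such a form, each of the four identities in play becomes
  a condition on \<open>f\<close> and \<open>g\<close>, and the conditions match in pairs: the left F-law and identity (A) are
  both equivalent to \<^emph>\<open>\<open>f\<close> and \<open>g\<close> commute and \<open>f\<close> is a central automorphism\<close>, that is,
  \<open>f\<close> moves every element by an element of the centre. The right F-law and identity (B) are both
  equivalent to the same condition with \<open>f\<close> and \<open>g\<close> exchanged. So, isotopy granted, not only the
  conjunctions but the single identities correspond.

  Two steps lead to the normal form. First, identity (A) at one fixed \<open>e = \<alpha> u\<close> already forces an
  isotopy to a group: with \<open>R\<close> and \<open>L\<close> the right and left translations by \<open>e\<close>, the operation
  \<open>R\<^sup>-\<^sup>1 p \<cdot> L\<^sup>-\<^sup>1 q\<close> is associative (\<open>isotopic_to_group_if_entropic_at\<close>). Second, an isotopy can be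
  moved to the carrier \<open>Q\<close> and made principal, \<open>x \<cdot> y = A x \<otimes> B y\<close>. A single instance of the
  left F-law, or of (A), with its first argument fixed says that \<open>B (s \<otimes> w)\<close> differs from
  \<open>B (c \<otimes> w)\<close> by a left factor depending on \<open>s\<close> only, and a bijection with this property is an
  automorphism followed by a left translation (\<open>right_factor_affine\<close>); likewise for \<open>A\<close> on the other
  side.

  Reversing the products of the group and of the quasigroup exchanges \<open>\<alpha>\<close> and \<open>\<beta>\<close>, the two F-laws,
  and (A) and (B). The affine form and the two conditions are therefore derived on one side only and transferred
  through the opposite group.
\<close>

section \<open>Opposite groups, the centre, and central automorphisms\<close>

definition opposite_group :: "('a, 'b) monoid_scheme \<Rightarrow> ('a, 'b) monoid_scheme"
  where "opposite_group G = G\<lparr>monoid.mult := \<lambda>x y. y \<otimes>\<^bsub>G\<^esub> x\<rparr>"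

definition centre :: "('a, 'b) monoid_scheme \<Rightarrow> 'a set"
  where "centre G = {z \<in> carrier G. \<forall>x\<in>carrier G. z \<otimes>\<^bsub>G\<^esub> x = x \<otimes>\<^bsub>G\<^esub> z}"

text \<open>An automorphism with this property is a central automorphism.\<close>

definition moves_by_centre :: "('a, 'b) monoid_scheme \<Rightarrow> ('a \<Rightarrow> 'a) \<Rightarrow> bool"
  where "moves_by_centre G f \<longleftrightarrow> (\<forall>x\<in>carrier G. \<exists>z\<in>centre G. f x = x \<otimes>\<^bsub>G\<^esub> z)"

lemma opposite_group_simps [simp]:
  "carrier (opposite_group G) = carrier G"
  "x \<otimes>\<^bsub>opposite_group G\<^esub> y = y \<otimes>\<^bsub>G\<^esub> x"
  "\<one>\<^bsub>opposite_group G\<^esub> = \<one>\<^bsub>G\<^esub>"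
  by (simp_all add: opposite_group_def)

lemma group_opposite_group:
  assumes "group G"
  shows "group (opposite_group G)"
proof -
  interpret group G by fact
  show ?thesis
  proof (rule groupI)
    fix x assume "x \<in> carrier (opposite_group G)"
    then show "\<exists>y\<in>carrier (opposite_group G). y \<otimes>\<^bsub>opposite_group G\<^esub> x = \<one>\<^bsub>opposite_group G\<^esub>"
      by (auto intro!: bexI[where x = "inv\<^bsub>G\<^esub> x"])
  qed (simp_all add: m_assoc)
qed

lemma iso_opposite_group: "iso (opposite_group G) (opposite_group G) = iso G G"
  by (auto simp: iso_def hom_def)

context group
begin

lemma inv_cancel_left:
  assumes "x \<in> carrier G" "y \<in> carrier G"
  shows "inv x \<otimes> (x \<otimes> y) = y" "x \<otimes> (inv x \<otimes> y) = y"
  using assms by (simp_all add: m_assoc[symmetric])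

lemmas word_simps = m_assoc inv_mult_group inv_cancel_left

lemma centreI:
  assumes "z \<in> carrier G" "\<And>x. x \<in> carrier G \<Longrightarrow> z \<otimes> x = x \<otimes> z"
  shows "z \<in> centre G"
  using assms by (simp add: centre_def)

lemma centre_closed: "z \<in> centre G \<Longrightarrow> z \<in> carrier G"
  by (simp add: centre_def)

lemma centre_commute: "z \<in> centre G \<Longrightarrow> x \<in> carrier G \<Longrightarrow> z \<otimes> x = x \<otimes> z"
  by (simp add: centre_def)

lemma inv_centre:
  assumes "z \<in> centre G"
  shows "inv z \<in> centre G"
proof -
  have "inv z \<otimes> x = x \<otimes> inv z" if "x \<in> carrier G" for x
  proof -
    have "z \<otimes> (inv z \<otimes> x) = x" "z \<otimes> (x \<otimes> inv z) = x"
      using assms that by (simp_all add: m_assoc[symmetric] centre_closed centre_commute) (simp add: m_assoc centre_closed)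
    then show ?thesis using assms that by (metis centre_closed inv_closed Units_eq Units_l_cancel m_closed)
  qed
  then show ?thesis using centre_closed[OF assms] by (intro centreI) auto
qed

lemma centre_left_commute:
  assumes "z \<in> centre G" "x \<in> carrier G" "y \<in> carrier G"
  shows "x \<otimes> (z \<otimes> y) = z \<otimes> (x \<otimes> y)"
  using assms by (simp add: m_assoc[symmetric] centre_closed centre_commute[OF assms(1,2)])

lemma centre_mult:
  assumes z: "z \<in> centre G" and w: "w \<in> centre G"
  shows "z \<otimes> w \<in> centre G"
proof -
  have "(z \<otimes> w) \<otimes> x = x \<otimes> (z \<otimes> w)" if x: "x \<in> carrier G" for x
  proof -
    have carr: "z \<in> carrier G" "w \<in> carrier G" using z w by (auto dest: centre_closed)
    have "(z \<otimes> w) \<otimes> x = z \<otimes> (x \<otimes> w)" using carr x by (simp only: m_assoc centre_commute[OF w x])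
    also have "\<dots> = x \<otimes> (z \<otimes> w)" using centre_left_commute[OF z x carr(2)] ..
    finally show ?thesis .
  qed
  then show ?thesis using centre_closed[OF z] centre_closed[OF w] by (intro centreI) auto
qed

text \<open>Centrality is stated here as triviality of an inner automorphism because the automorphisms
  \<open>f\<close>, \<open>g\<close> of an affine form are compared below up to conjugation.\<close>

lemma centreI_conjugation:
  assumes d: "d \<in> carrier G" and conj: "\<And>q. q \<in> carrier G \<Longrightarrow> d \<otimes> q \<otimes> inv d = q"
  shows "d \<in> centre G"
proof -
  have "d \<otimes> q = q \<otimes> d" if q: "q \<in> carrier G" for q
  proof -
    have "d \<otimes> q = d \<otimes> q \<otimes> inv d \<otimes> d" using d q by (simp add: m_assoc)
    also have "\<dots> = q \<otimes> d" by (simp only: conj[OF q])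
    finally show ?thesis .
  qed
  then show ?thesis using d by (intro centreI)
qed

lemma centre_if_automorphic_image_in_centre:
  assumes f: "f \<in> iso G G" and d: "d \<in> carrier G" and fd: "f d \<in> centre G"
  shows "d \<in> centre G"
proof -
  have hom: "f (x \<otimes> y) = f x \<otimes> f y" if "x \<in> carrier G" "y \<in> carrier G" for x y
    using f that by (auto simp: iso_def hom_def)
  have bij: "bij_betw f (carrier G) (carrier G)" using f by (simp add: iso_def)
  have "d \<otimes> x = x \<otimes> d" if x: "x \<in> carrier G" for x
  proof -
    have "f x \<in> carrier G" using bij x by (auto simp: bij_betw_def)
    then have "f (d \<otimes> x) = f (x \<otimes> d)"
      using centre_commute[OF fd] by (simp add: hom d x)
    then show ?thesis using bij d x by (auto simp: bij_betw_def inj_on_def)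
  qed
  then show ?thesis using d by (intro centreI)
qed

end

section \<open>From one entropic identity to a group\<close>

lemma (in quasigroup) mult_closed: "x \<in> Q \<Longrightarrow> y \<in> Q \<Longrightarrow> x \<cdot> y \<in> Q"
  using left_translation by (auto simp: bij_betw_def)

lemma (in quasigroup) rdiv_exists: "a \<in> Q \<Longrightarrow> b \<in> Q \<Longrightarrow> \<exists>x\<in>Q. x \<cdot> a = b"
  using bij_betw_imp_surj_on[OF right_translation[of a]] by (metis imageE)

lemma (in quasigroup) opposite_quasigroup: "quasigroup Q (\<lambda>x y. y \<cdot> x)"
  by unfold_locales (simp_all add: nonempty left_translation right_translation)

text \<open>
  The candidate group has \<open>(x \<cdot> e) \<circ>\<^sub>e (e \<cdot> v) = x \<cdot> v\<close>, and \<open>e \<cdot> e\<close> is its identity. In terms of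
  \<open>\<circ>\<^sub>e\<close> the hypothesis becomes \<open>(x \<cdot> y \<cdot> e) \<circ>\<^sub>e q = p \<circ>\<^sub>e (e \<cdot> (y \<cdot> v))\<close> with \<open>p = x \<cdot> e \<cdot> e\<close> and
  \<open>q = e \<cdot> (e \<cdot> v)\<close> arbitrary. This is associativity once \<open>x \<cdot> y \<cdot> e\<close> is recognised as \<open>p \<circ>\<^sub>e s\<close> and
  \<open>e \<cdot> (y \<cdot> v)\<close> as \<open>s \<circ>\<^sub>e q\<close>, where \<open>s\<close> depends on \<open>y\<close> alone. Both follow by specialising \<open>x\<close> or
  \<open>v\<close> so that \<open>p\<close> or \<open>q\<close> is the identity.
\<close>

lemma (in quasigroup) isotopic_to_group_if_entropic_at:
  assumes e: "e \<in> Q"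
    and entropic: "\<forall>x\<in>Q. \<forall>y\<in>Q. \<forall>v\<in>Q. (x \<cdot> y) \<cdot> (e \<cdot> v) = (x \<cdot> e) \<cdot> (y \<cdot> v)"
  shows "isotopic_to_group Q (\<cdot>)"
proof -
  define R where "R = inv_into Q (\<lambda>x. x \<cdot> e)"
  define L where "L = inv_into Q (\<lambda>x. e \<cdot> x)"
  define op (infixl "\<circ>\<^sub>e" 70) where "p \<circ>\<^sub>e q = R p \<cdot> L q" for p q
  note closed = mult_closed e
  have R: "R p \<in> Q" "R p \<cdot> e = p" "R (p \<cdot> e) = p" if "p \<in> Q" for p
    using bij_betw_inv_into_left[OF right_translation[OF e]] bij_betw_inv_into_right[OF right_translation[OF e]]
      bij_betw_apply[OF bij_betw_inv_into[OF right_translation[OF e]]] that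
    by (simp_all add: R_def)
  have L: "L p \<in> Q" "e \<cdot> L p = p" "L (e \<cdot> p) = p" if "p \<in> Q" for p
    using bij_betw_inv_into_left[OF left_translation[OF e]] bij_betw_inv_into_right[OF left_translation[OF e]]
      bij_betw_apply[OF bij_betw_inv_into[OF left_translation[OF e]]] that
    by (simp_all add: L_def)
  have op_closed: "p \<circ>\<^sub>e q \<in> Q" if "p \<in> Q" "q \<in> Q" for p q
    using that by (simp add: op_def closed R L)
  have op_shift: "(x \<cdot> e) \<circ>\<^sub>e (e \<cdot> v) = x \<cdot> v" if "x \<in> Q" "v \<in> Q" for x v
    using that by (simp add: op_def R L)
  have unit: "(e \<cdot> e) \<circ>\<^sub>e p = p" "p \<circ>\<^sub>e (e \<cdot> e) = p" if "p \<in> Q" for p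
    using that by (simp_all add: op_def R L e)
  have op_cancel: "p = p'" if "p \<circ>\<^sub>e q = p' \<circ>\<^sub>e q" "p \<in> Q" "p' \<in> Q" "q \<in> Q" for p p' q
  proof -
    have "R p = R p'"
      using that right_translation[of "L q"] by (simp add: op_def R L bij_betw_def inj_on_def)
    then show ?thesis using that R(2) by metis
  qed
  have key: "(x \<cdot> y \<cdot> e) \<circ>\<^sub>e (e \<cdot> (e \<cdot> v)) = (x \<cdot> e \<cdot> e) \<circ>\<^sub>e (e \<cdot> (y \<cdot> v))"
    if "x \<in> Q" "y \<in> Q" "v \<in> Q" for x y v
    using that bspec[OF bspec[OF bspec[OF entropic]]] by (simp add: op_shift closed)
  have assoc: "(p \<circ>\<^sub>e s) \<circ>\<^sub>e q = p \<circ>\<^sub>e (s \<circ>\<^sub>e q)" if p: "p \<in> Q" and s: "s \<in> Q" and q: "q \<in> Q" for p s q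
  proof -
    define x where "x = R (R p)"
    define v where "v = L (L q)"
    \<comment> \<open>\<open>x0\<close> and \<open>v0\<close> below are the choices of \<open>x\<close> and \<open>v\<close> that make the outer factors the
      identity \<open>e \<cdot> e\<close>. The factor \<open>e \<cdot> (e \<cdot> e)\<close> in \<open>y\<close> is \<open>q\<close> for \<open>v = e\<close>; cancelling it makes
      \<open>x0 \<cdot> y \<cdot> e\<close> equal to \<open>s\<close>.\<close>
    define y where "y = R (L (s \<circ>\<^sub>e (e \<cdot> (e \<cdot> e))))"
    define x0 where "x0 = R e"
    define v0 where "v0 = L e"
    have mem: "x \<in> Q" "y \<in> Q" "v \<in> Q" "x0 \<in> Q" "v0 \<in> Q"
      by (simp_all add: x_def y_def v_def x0_def v0_def p s q R L op_closed closed)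
    have x: "x \<cdot> e \<cdot> e = p" "x0 \<cdot> e \<cdot> e = e \<cdot> e" and v: "e \<cdot> (e \<cdot> v) = q" "e \<cdot> (e \<cdot> v0) = e \<cdot> e"
      and y: "e \<cdot> (y \<cdot> e) = s \<circ>\<^sub>e (e \<cdot> (e \<cdot> e))"
      by (simp_all add: x_def y_def v_def x0_def v0_def p s q R L op_closed closed)
    have "(x0 \<cdot> y \<cdot> e) \<circ>\<^sub>e (e \<cdot> (e \<cdot> e)) = s \<circ>\<^sub>e (e \<cdot> (e \<cdot> e))"
      using key[of x0 y e] mem by (simp add: x y unit op_closed s closed)
    then have "x0 \<cdot> y \<cdot> e = s"
      by (rule op_cancel) (simp_all add: closed mem s)
    then have s_op: "s \<circ>\<^sub>e (e \<cdot> (e \<cdot> w)) = e \<cdot> (y \<cdot> w)" if "w \<in> Q" for w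
      using key[of x0 y w] mem that by (simp add: x unit closed)
    have xy_op: "(x \<cdot> y \<cdot> e) \<circ>\<^sub>e (e \<cdot> (e \<cdot> w)) = p \<circ>\<^sub>e (s \<circ>\<^sub>e (e \<cdot> (e \<cdot> w)))" if "w \<in> Q" for w
      using key[of x y w] mem that by (simp add: x s_op)
    have "x \<cdot> y \<cdot> e = p \<circ>\<^sub>e s"
      using xy_op[of v0] mem by (simp add: v unit s closed)
    then show ?thesis using xy_op[of v] mem by (simp add: v)
  qed
  define G :: "'a monoid" where "G = \<lparr>carrier = Q, monoid.mult = (\<circ>\<^sub>e), one = e \<cdot> e\<rparr>"
  have "group G"
  proof (rule groupI)
    fix x assume "x \<in> carrier G"
    then have x: "x \<in> Q" by (simp add: G_def)
    obtain z where z: "z \<in> Q" "z \<cdot> L x = e \<cdot> e"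
      using rdiv_exists[of "L x" "e \<cdot> e"] x by (auto simp: L closed)
    then have "(z \<cdot> e) \<circ>\<^sub>e x = e \<cdot> e" by (simp add: op_def R x)
    then show "\<exists>y\<in>carrier G. y \<otimes>\<^bsub>G\<^esub> x = \<one>\<^bsub>G\<^esub>"
      using z by (auto simp: G_def closed)
  qed (simp_all add: G_def op_closed unit assoc closed)
  moreover have "isotopic_to Q (\<cdot>) G"
    unfolding isotopic_to_def
    using right_translation[OF e] left_translation[OF e] bij_betw_id[of Q] op_shift
    by (intro exI[where x = "\<lambda>x. x \<cdot> e"] exI[where x = "\<lambda>x. e \<cdot> x"] exI[where x = id]) (simp add: G_def)
  ultimately show ?thesis by (auto simp: isotopic_to_group_def)
qed

section \<open>Principal isotopes of groups\<close>

locale principal_isotope = group G + quasigroup "carrier G" mult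
  for G :: "('a, 'b) monoid_scheme" (structure) and mult :: "'a \<Rightarrow> 'a \<Rightarrow> 'a" (infixl "\<cdot>" 70) +
  fixes A B :: "'a \<Rightarrow> 'a"
  assumes A_bij: "bij_betw A (carrier G) (carrier G)"
    and B_bij: "bij_betw B (carrier G) (carrier G)"
    and mult_eq: "x \<in> carrier G \<Longrightarrow> y \<in> carrier G \<Longrightarrow> x \<cdot> y = A x \<otimes> B y"

text \<open>If \<open>c (x \<cdot> y) = a x \<otimes> b y\<close>, then pulling the group structure back along \<open>c\<close> turns the third
  map of the isotopy into the identity.\<close>

lemma (in quasigroup) principal_isotope_exists:
  assumes "isotopic_to_group Q (\<cdot>)"
  shows "\<exists>(G :: 'a monoid) A B. carrier G = Q \<and> principal_isotope G (\<cdot>) A B"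
proof -
  obtain H :: "'a monoid" and a b c where "group H"
    and a: "bij_betw a Q (carrier H)" and b: "bij_betw b Q (carrier H)" and c: "bij_betw c Q (carrier H)"
    and eq: "\<And>x y. x \<in> Q \<Longrightarrow> y \<in> Q \<Longrightarrow> c (x \<cdot> y) = a x \<otimes>\<^bsub>H\<^esub> b y"
    using assms by (auto simp: isotopic_to_group_def isotopic_to_def)
  interpret H: group H by fact
  define d where "d = inv_into Q c"
  have d: "bij_betw d (carrier H) Q"
    unfolding d_def by (rule bij_betw_inv_into[OF c])
  have cd: "c (d h) = h" if "h \<in> carrier H" for h
    unfolding d_def using c that by (simp add: bij_betw_inv_into_right)
  have dc: "d (c x) = x" if "x \<in> Q" for x
    unfolding d_def using c that by (simp add: bij_betw_inv_into_left)
  have maps: "a x \<in> carrier H" "b x \<in> carrier H" "c x \<in> carrier H" if "x \<in> Q" for x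
    using a b c that by (auto simp: bij_betw_def)
  have dQ: "d h \<in> Q" if "h \<in> carrier H" for h
    using d that by (auto simp: bij_betw_def)
  define G :: "'a monoid"
    where "G = \<lparr>carrier = Q, monoid.mult = (\<lambda>x y. d (c x \<otimes>\<^bsub>H\<^esub> c y)), one = d \<one>\<^bsub>H\<^esub>\<rparr>"
  have "group G"
  proof (rule groupI)
    fix x assume "x \<in> carrier G"
    then show "\<exists>y\<in>carrier G. y \<otimes>\<^bsub>G\<^esub> x = \<one>\<^bsub>G\<^esub>"
      by (intro bexI[where x = "d (inv\<^bsub>H\<^esub> c x)"]) (simp_all add: G_def cd dQ maps)
  qed (simp_all add: G_def dQ maps cd dc H.m_assoc)
  moreover have "x \<cdot> y = (d \<circ> a) x \<otimes>\<^bsub>G\<^esub> (d \<circ> b) y" if "x \<in> Q" "y \<in> Q" for x y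
    using that dc[of "x \<cdot> y"] by (simp add: G_def cd maps eq mult_closed)
  ultimately have "principal_isotope G (\<cdot>) (d \<circ> a) (d \<circ> b)"
    using bij_betw_trans[OF a d] bij_betw_trans[OF b d] quasigroup_axioms
    by (simp add: principal_isotope_def principal_isotope_axioms_def G_def)
  then show ?thesis by (intro exI[where x = G] exI conjI) (auto simp: G_def)
qed

text \<open>At \<open>s = w = \<one>\<close> the hypothesis gives \<open>k = inv (B \<one>)\<close>, so \<open>x \<mapsto> k \<otimes> B x\<close> is the
  automorphism.\<close>

lemma (in group) iso_if_twisted_hom:
  assumes B: "bij_betw B (carrier G) (carrier G)" and k: "k \<in> carrier G"
    and twisted: "\<And>s w. s \<in> carrier G \<Longrightarrow> w \<in> carrier G \<Longrightarrow> B (s \<otimes> w) = B s \<otimes> k \<otimes> B w"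
  shows "\<exists>g\<in>iso G G. \<forall>x\<in>carrier G. B x = B \<one> \<otimes> g x"
proof -
  have B_closed: "B x \<in> carrier G" if "x \<in> carrier G" for x
    using B that by (auto simp: bij_betw_def)
  have Bk: "B \<one> \<otimes> k = \<one>"
    using twisted[of \<one> \<one>] k by (simp add: B_closed)
  define g where "g x = k \<otimes> B x" for x
  have "bij_betw (\<lambda>y. k \<otimes> y) (carrier G) (carrier G)"
    using k by (intro bij_betwI[where g = "\<lambda>y. inv k \<otimes> y"]) (auto simp: m_assoc[symmetric])
  from bij_betw_trans[OF B this] have "bij_betw g (carrier G) (carrier G)"
    by (simp add: g_def[abs_def] comp_def)
  then have "g \<in> iso G G"
    using k B_closed by (auto simp: iso_def hom_def g_def twisted m_assoc)
  moreover have "B x = B \<one> \<otimes> g x" if "x \<in> carrier G" for x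
  proof -
    have "B \<one> \<otimes> g x = B \<one> \<otimes> k \<otimes> B x" using that k by (simp add: g_def m_assoc B_closed)
    also have "\<dots> = B x" using that by (simp add: Bk B_closed)
    finally show ?thesis ..
  qed
  ultimately show ?thesis by blast
qed

context principal_isotope
begin

lemma A_closed [simp]: "x \<in> carrier G \<Longrightarrow> A x \<in> carrier G"
  using A_bij by (auto simp: bij_betw_def)

lemma B_closed [simp]: "x \<in> carrier G \<Longrightarrow> B x \<in> carrier G"
  using B_bij by (auto simp: bij_betw_def)

lemma opposite: "principal_isotope (opposite_group G) (\<lambda>x y. y \<cdot> x) B A"
  using opposite_quasigroup group_opposite_group[OF is_group] A_bij B_bij
  by (simp add: principal_isotope_def principal_isotope_axioms_def mult_eq)

text \<open>
  The hypothesis abstracts what the left F-law (with \<open>p\<close> fixed, \<open>r y = p \<cdot> y\<close> and \<open>e = \<alpha> p\<close>) and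
  identity (A) (with \<open>p = x \<cdot> e\<close> and \<open>r y = x \<cdot> y\<close>) have in common. In the group it reads
  \<open>B (s \<otimes> w) = D s \<otimes> B (c \<otimes> w)\<close> with \<open>c = A e\<close>; putting \<open>w = \<one>\<close> and \<open>s = \<one>\<close> expresses \<open>D s\<close> and
  \<open>B (c \<otimes> w)\<close> through \<open>B s\<close> and \<open>B w\<close>.
\<close>

lemma right_factor_affine:
  assumes p: "p \<in> carrier G" and e: "e \<in> carrier G"
    and r: "\<And>y. y \<in> carrier G \<Longrightarrow> r y \<in> carrier G"
    and shift: "\<And>y z. y \<in> carrier G \<Longrightarrow> z \<in> carrier G \<Longrightarrow> p \<cdot> (y \<cdot> z) = r y \<cdot> (e \<cdot> z)"
  shows "\<exists>g\<in>iso G G. \<forall>x\<in>carrier G. B x = B \<one> \<otimes> g x"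
proof -
  define A' where "A' = inv_into (carrier G) A"
  define D where "D s = inv (A p) \<otimes> A (r (A' s))" for s
  have A': "A' s \<in> carrier G" "A (A' s) = s" if "s \<in> carrier G" for s
    using bij_betw_apply[OF bij_betw_inv_into[OF A_bij]] bij_betw_inv_into_right[OF A_bij] that
    by (simp_all add: A'_def)
  have D_closed [simp]: "D s \<in> carrier G" if "s \<in> carrier G" for s
    using that by (simp add: D_def p r A')
  have B_split: "B (s \<otimes> w) = D s \<otimes> B (A e \<otimes> w)" if s: "s \<in> carrier G" and w: "w \<in> carrier G" for s w
  proof -
    obtain z where z: "z \<in> carrier G" "B z = w"
      using bij_betw_imp_surj_on[OF B_bij] w by (metis imageE)
    have "A p \<otimes> B (s \<otimes> w) = A (r (A' s)) \<otimes> B (A e \<otimes> w)"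
      using shift[of "A' s" z] s w z by (simp add: mult_eq p e r A')
    then have "inv (A p) \<otimes> (A p \<otimes> B (s \<otimes> w)) = D s \<otimes> B (A e \<otimes> w)"
      using s w by (simp add: D_def m_assoc p e r A')
    moreover have "inv (A p) \<otimes> (A p \<otimes> B (s \<otimes> w)) = B (s \<otimes> w)"
      using s w p by (simp add: m_assoc[symmetric])
    ultimately show ?thesis by simp
  qed
  have "B (s \<otimes> w) = B s \<otimes> (inv (B (A e)) \<otimes> inv (D \<one>)) \<otimes> B w"
    if s: "s \<in> carrier G" and w: "w \<in> carrier G" for s w
  proof -
    have "B s = D s \<otimes> B (A e)" "B w = D \<one> \<otimes> B (A e \<otimes> w)"
      using B_split[of s \<one>] B_split[of \<one> w] s w e by simp_all
    then have "B s \<otimes> (inv (B (A e)) \<otimes> inv (D \<one>)) \<otimes> B w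
        = (D s \<otimes> (B (A e) \<otimes> inv (B (A e)))) \<otimes> ((inv (D \<one>) \<otimes> D \<one>) \<otimes> B (A e \<otimes> w))"
      using s w e by (simp only: m_assoc A_closed B_closed D_closed inv_closed m_closed one_closed)
    also have "\<dots> = B (s \<otimes> w)"
      using s w e by (simp only: r_inv l_inv l_one r_one B_split[OF s w] A_closed B_closed D_closed m_closed one_closed)
    finally show ?thesis ..
  qed
  then show ?thesis
    using e by (intro iso_if_twisted_hom[OF B_bij, of "inv (B (A e)) \<otimes> inv (D \<one>)"]) simp_all
qed

end

section \<open>Affine quasigroups over a group\<close>

locale affine_quasigroup = group G + quasigroup "carrier G" mult
  for G :: "('a, 'b) monoid_scheme" (structure) and mult :: "'a \<Rightarrow> 'a \<Rightarrow> 'a" (infixl "\<cdot>" 70) +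
  fixes f g :: "'a \<Rightarrow> 'a" and a :: 'a
  assumes f_iso: "f \<in> iso G G" and g_iso: "g \<in> iso G G" and a [simp]: "a \<in> carrier G"
    and mult_eq: "x \<in> carrier G \<Longrightarrow> y \<in> carrier G \<Longrightarrow> x \<cdot> y = f x \<otimes> a \<otimes> g y"

text \<open>Here \<open>B x = B \<one> \<otimes> g x\<close> and, from the opposite isotope, \<open>A x = f x \<otimes> A \<one>\<close>, so the
  constant in the middle is \<open>a = A \<one> \<otimes> B \<one>\<close>.\<close>

lemma (in principal_isotope) affine_if_shifts:
  assumes left: "p \<in> carrier G" "e \<in> carrier G" "\<And>y. y \<in> carrier G \<Longrightarrow> r y \<in> carrier G"
      "\<And>y z. y \<in> carrier G \<Longrightarrow> z \<in> carrier G \<Longrightarrow> p \<cdot> (y \<cdot> z) = r y \<cdot> (e \<cdot> z)"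
    and right: "p' \<in> carrier G" "e' \<in> carrier G" "\<And>y. y \<in> carrier G \<Longrightarrow> r' y \<in> carrier G"
      "\<And>y z. y \<in> carrier G \<Longrightarrow> z \<in> carrier G \<Longrightarrow> (z \<cdot> y) \<cdot> p' = (z \<cdot> e') \<cdot> r' y"
  shows "\<exists>f g a. affine_quasigroup G (\<cdot>) f g a"
proof -
  interpret opp: principal_isotope "opposite_group G" "\<lambda>x y. y \<cdot> x" B A
    by (rule opposite)
  have "\<exists>g\<in>iso G G. \<forall>x\<in>carrier G. B x = B \<one> \<otimes> g x"
    by (rule right_factor_affine[of p e r]) (simp_all only: left)
  then obtain g where g: "g \<in> iso G G" "\<forall>x\<in>carrier G. B x = B \<one> \<otimes> g x"
    by (elim bexE)
  have "\<exists>f\<in>iso (opposite_group G) (opposite_group G).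
      \<forall>x\<in>carrier (opposite_group G). A x = A \<one>\<^bsub>opposite_group G\<^esub> \<otimes>\<^bsub>opposite_group G\<^esub> f x"
    by (rule opp.right_factor_affine[of p' e' r']) (simp_all only: opposite_group_simps right)
  then obtain f where f: "f \<in> iso G G" "\<forall>x\<in>carrier G. A x = f x \<otimes> A \<one>"
    by (elim bexE) (simp only: iso_opposite_group opposite_group_simps)
  have "x \<cdot> y = f x \<otimes> (A \<one> \<otimes> B \<one>) \<otimes> g y" if x: "x \<in> carrier G" and y: "y \<in> carrier G" for x y
  proof -
    have fg: "f x \<in> carrier G" "g y \<in> carrier G"
      using f(1) g(1) x y by (auto simp: iso_def bij_betw_def)
    have "x \<cdot> y = (f x \<otimes> A \<one>) \<otimes> (B \<one> \<otimes> g y)"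
      unfolding mult_eq[OF x y] bspec[OF f(2) x] bspec[OF g(2) y] ..
    then show ?thesis
      using fg by (simp only: m_assoc A_closed B_closed one_closed m_closed)
  qed
  then have "affine_quasigroup G (\<cdot>) f g (A \<one> \<otimes> B \<one>)"
    using f(1) g(1) by (intro affine_quasigroup.intro affine_quasigroup_axioms.intro) 
      (simp_all add: is_group quasigroup_axioms)
  then show ?thesis by (intro exI)
qed

context affine_quasigroup
begin

abbreviation right_unit_of :: "'a \<Rightarrow> 'a"
  where "right_unit_of \<equiv> right_unit (carrier G) (\<cdot>)"

lemma f_closed [simp]: "x \<in> carrier G \<Longrightarrow> f x \<in> carrier G"
  and g_closed [simp]: "x \<in> carrier G \<Longrightarrow> g x \<in> carrier G"
  using f_iso g_iso by (auto simp: iso_def bij_betw_def)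

lemma f_mult: "x \<in> carrier G \<Longrightarrow> y \<in> carrier G \<Longrightarrow> f (x \<otimes> y) = f x \<otimes> f y"
  and g_mult: "x \<in> carrier G \<Longrightarrow> y \<in> carrier G \<Longrightarrow> g (x \<otimes> y) = g x \<otimes> g y"
  using f_iso g_iso by (auto simp: iso_def hom_def)

lemma f_one [simp]: "f \<one> = \<one>"
  using f_mult[of \<one> \<one>] by simp

lemma g_one [simp]: "g \<one> = \<one>"
  using g_mult[of \<one> \<one>] by simp

lemma f_inv: "x \<in> carrier G \<Longrightarrow> f (inv x) = inv (f x)"
  using f_mult[of "inv x" x] inv_equality[of "f (inv x)" "f x"] by simp

lemma f_onto:
  assumes "y \<in> carrier G"
  obtains x where "x \<in> carrier G" "f x = y"
  using f_iso bij_betw_imp_surj_on[of f "carrier G" "carrier G"] assms that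
  by (metis (no_types, lifting) imageE iso_iff)

lemma g_onto:
  assumes "y \<in> carrier G"
  obtains x where "x \<in> carrier G" "g x = y"
  using g_iso bij_betw_imp_surj_on[of g "carrier G" "carrier G"] assms that
  by (metis (no_types, lifting) imageE iso_iff)

lemma opposite: "affine_quasigroup (opposite_group G) (\<lambda>x y. y \<cdot> x) g f a"
  using opposite_quasigroup group_opposite_group[OF is_group] f_iso g_iso
  by (simp add: affine_quasigroup_def affine_quasigroup_axioms_def iso_opposite_group mult_eq m_assoc)

lemma right_unit_of_closed [simp]: "x \<in> carrier G \<Longrightarrow> right_unit_of x \<in> carrier G"
  by (rule right_unit)

lemma right_unit_equation: "x \<in> carrier G \<Longrightarrow> f x \<otimes> (a \<otimes> g (right_unit_of x)) = x"
  using right_unit[of x] by (simp add: mult_eq m_assoc)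

lemma right_nested_product:
  assumes "x \<in> carrier G" "y \<in> carrier G" "z \<in> carrier G"
  shows "x \<cdot> (y \<cdot> z) = f x \<otimes> a \<otimes> g (f y) \<otimes> (g a \<otimes> g (g z))"
  using assms by (simp add: mult_eq g_mult m_assoc)

lemma product_of_products:
  assumes "x \<in> carrier G" "y \<in> carrier G" "u \<in> carrier G" "v \<in> carrier G"
  shows "(x \<cdot> y) \<cdot> (u \<cdot> v)
    = f (f x) \<otimes> f a \<otimes> (f (g y) \<otimes> a \<otimes> g (f u)) \<otimes> (g a \<otimes> g (g v))"
  using assms by (simp add: mult_eq f_mult g_mult m_assoc)

text \<open>Both sides of each identity below share their outer factors: the last one,
  \<open>g a \<otimes> g (g z)\<close> (with \<open>v\<close> for \<open>z\<close> in the second), and in the second identity also the first one,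
  \<open>f (f x) \<otimes> f a\<close>. These cancel, and with them \<open>z\<close> in the first and \<open>x\<close>, \<open>v\<close> in the second.\<close>

lemma left_distributive_at_iff:
  assumes "x \<in> carrier G" "y \<in> carrier G" "z \<in> carrier G" "e \<in> carrier G"
  shows "x \<cdot> (y \<cdot> z) = (x \<cdot> y) \<cdot> (e \<cdot> z)
    \<longleftrightarrow> f x \<otimes> a \<otimes> g (f y) = f (f x) \<otimes> f a \<otimes> (f (g y) \<otimes> a \<otimes> g (f e))"
  unfolding right_nested_product[OF assms(1,2,3)] product_of_products[OF assms(1,2,4,3)]
  using assms by (intro right_cancel) simp_all

lemma entropic_at_iff:
  assumes "x \<in> carrier G" "y \<in> carrier G" "e \<in> carrier G" "v \<in> carrier G"
  shows "(x \<cdot> y) \<cdot> (e \<cdot> v) = (x \<cdot> e) \<cdot> (y \<cdot> v)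
    \<longleftrightarrow> f (g y) \<otimes> a \<otimes> g (f e) = f (g e) \<otimes> a \<otimes> g (f y)"
  unfolding product_of_products[OF assms] product_of_products[OF assms(1,3,2,4)]
  using assms by simp

text \<open>
  Write \<open>u = f x \<otimes> a\<close>, which is arbitrary, and \<open>k = g (f (\<alpha> x))\<close>. The reduced left F-law is
  \<open>u \<otimes> g (f y) = f u \<otimes> f (g y) \<otimes> (a \<otimes> k)\<close>. Its instance \<open>y = \<one>\<close> determines
  \<open>a \<otimes> k = inv (f u) \<otimes> u\<close>, and then the law says that conjugation by \<open>inv u \<otimes> f u\<close> takes \<open>f (g y)\<close>
  to \<open>g (f y)\<close>, for every \<open>u\<close>. For \<open>u = \<one>\<close> this is commutation of \<open>f\<close> and \<open>g\<close>, and hence every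
  \<open>inv u \<otimes> f u\<close> is central.
\<close>

lemma left_F_iff:
  "left_F_quasigroup (carrier G) (\<cdot>)
    \<longleftrightarrow> (\<forall>y\<in>carrier G. f (g y) = g (f y)) \<and> moves_by_centre G f"
proof
  assume "left_F_quasigroup (carrier G) (\<cdot>)"
  then have F: "f x \<otimes> a \<otimes> g (f y) = f (f x) \<otimes> f a \<otimes> (f (g y) \<otimes> a \<otimes> g (f (right_unit_of x)))"
    if "x \<in> carrier G" "y \<in> carrier G" for x y
    using that left_distributive_at_iff[of x y y "right_unit_of x"]
    by (simp add: left_F_quasigroup_def)
  have conj: "g (f y) = (inv u \<otimes> f u) \<otimes> f (g y) \<otimes> inv (inv u \<otimes> f u)"
    if u: "u \<in> carrier G" and y: "y \<in> carrier G" for u y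
  proof -
    obtain x where x: "x \<in> carrier G" "f x = u \<otimes> inv a"
      using f_onto[of "u \<otimes> inv a"] u by auto
    define k where "k = g (f (right_unit_of x))"
    have k: "k \<in> carrier G" using x by (simp add: k_def)
    have u_eq: "f x \<otimes> a = u" using x(2) u by (simp add: m_assoc)
    then have fu_eq: "f (f x) \<otimes> f a = f u" using x(1) by (simp add: f_mult[symmetric])
    have F': "u \<otimes> g (f y) = f u \<otimes> (f (g y) \<otimes> a \<otimes> k)" if "y \<in> carrier G" for y
      using F[OF x(1) that] by (simp only: u_eq fu_eq k_def)
    have "u = f u \<otimes> (a \<otimes> k)"
      using F'[of \<one>] u k by simp
    then have "a \<otimes> k = inv (f u) \<otimes> u"
      using inv_solve_left[of "a \<otimes> k" "f u" u] u k by simp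
    moreover have "g (f y) = inv u \<otimes> (f u \<otimes> (f (g y) \<otimes> a \<otimes> k))"
      using inv_solve_left[of "g (f y)" u "f u \<otimes> (f (g y) \<otimes> a \<otimes> k)"] F'[OF y] u y k by simp
    ultimately show ?thesis
      using u y k by (simp add: word_simps)
  qed
  have comm: "f (g y) = g (f y)" if "y \<in> carrier G" for y
    using conj[of \<one> y] that by simp
  have "inv u \<otimes> f u \<in> centre G" if u: "u \<in> carrier G" for u
  proof (rule centreI_conjugation)
    fix q assume q: "q \<in> carrier G"
    obtain y' where y': "y' \<in> carrier G" "g y' = q" using g_onto[OF q] .
    obtain y where y: "y \<in> carrier G" "f y = y'" using f_onto[OF y'(1)] .
    show "(inv u \<otimes> f u) \<otimes> q \<otimes> inv (inv u \<otimes> f u) = q"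
      using conj[OF u y(1)] comm[OF y(1)] y y' by simp
  qed (use u in simp)
  then have "moves_by_centre G f"
    unfolding moves_by_centre_def
    by (metis f_closed inv_cancel_left(2))
  with comm show "(\<forall>y\<in>carrier G. f (g y) = g (f y)) \<and> moves_by_centre G f" by simp
next
  assume "(\<forall>y\<in>carrier G. f (g y) = g (f y)) \<and> moves_by_centre G f"
  then have comm: "\<And>y. y \<in> carrier G \<Longrightarrow> f (g y) = g (f y)"
    and central: "\<And>y. y \<in> carrier G \<Longrightarrow> \<exists>z\<in>centre G. f y = y \<otimes> z"
    by (simp_all add: moves_by_centre_def)
  have "f x \<otimes> a \<otimes> g (f y) = f (f x) \<otimes> f a \<otimes> (f (g y) \<otimes> a \<otimes> g (f (right_unit_of x)))"
    if x: "x \<in> carrier G" and y: "y \<in> carrier G" for x y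
  proof -
    define p where "p = f x"
    define q where "q = f (g y)"
    define k where "k = f (g (right_unit_of x))"
    have carr: "p \<in> carrier G" "q \<in> carrier G" "k \<in> carrier G"
      using x y by (simp_all add: p_def q_def k_def)
    obtain z where z: "z \<in> centre G" "f p = p \<otimes> z" using central[of p] carr by auto
    obtain w where w: "w \<in> centre G" "f a = a \<otimes> w" using central[of a] by auto
    define t where "t = z \<otimes> w"
    have t: "t \<in> centre G" using z w by (simp add: t_def centre_mult)
    note centre_carr = centre_closed[OF z(1)] centre_closed[OF w(1)] centre_closed[OF t]
    \<comment> \<open>\<open>f p\<close> and \<open>f a\<close> differ from \<open>p\<close> and \<open>a\<close> by the central factor \<open>t\<close>, and applying \<open>f\<close> to the
      equation for \<open>\<alpha> x\<close> shows that \<open>a \<otimes> k\<close> is exactly the inverse of \<open>t\<close>.\<close>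
    have shift: "f p \<otimes> f a = p \<otimes> a \<otimes> t"
      using carr centre_carr centre_left_commute[OF z(1), of a w]
      by (simp only: z(2) w(2) t_def m_assoc a m_closed)
    have "f (p \<otimes> (a \<otimes> g (right_unit_of x))) = p"
      using right_unit_equation[OF x] by (simp add: p_def)
    then have "p \<otimes> a \<otimes> t \<otimes> k = p"
      using x carr by (simp add: f_mult k_def shift[symmetric] m_assoc)
    then have "p \<otimes> (t \<otimes> (a \<otimes> k)) = p"
      using carr centre_carr centre_left_commute[OF t, of a k] by (simp only: m_assoc a m_closed)
    then have inverse: "t \<otimes> (a \<otimes> k) = \<one>"
      using carr centre_carr by simp
    have "f p \<otimes> f a \<otimes> (q \<otimes> a \<otimes> k) = p \<otimes> a \<otimes> (t \<otimes> (q \<otimes> (a \<otimes> k)))"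
      unfolding shift using carr centre_carr by (simp only: m_assoc a m_closed)
    also have "t \<otimes> (q \<otimes> (a \<otimes> k)) = q \<otimes> (t \<otimes> (a \<otimes> k))"
      using carr centre_left_commute[OF t, of q "a \<otimes> k"] by simp
    also have "p \<otimes> a \<otimes> (q \<otimes> (t \<otimes> (a \<otimes> k))) = p \<otimes> a \<otimes> q"
      unfolding inverse using carr by simp
    finally show ?thesis
      using x y by (simp add: p_def q_def k_def comm)
  qed
  then show "left_F_quasigroup (carrier G) (\<cdot>)"
    by (simp add: left_F_quasigroup_def quasigroup_axioms left_distributive_at_iff)
qed

text \<open>
  With \<open>e = \<alpha> u\<close> the identity reduces to \<open>f (g y) \<otimes> a \<otimes> g (f e) = f (g e) \<otimes> a \<otimes> g (f y)\<close>. The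
  instance \<open>y = \<one>\<close> shows that \<open>a \<otimes> g (f e)\<close> and \<open>f (g e) \<otimes> a\<close> are the same element \<open>c u\<close>, so \<open>c u\<close>
  conjugates \<open>g (f y)\<close> to \<open>f (g y)\<close>. As \<open>u\<close> varies, \<open>c u\<close> can therefore change only by central
  factors. Comparing \<open>u\<close> with \<open>\<one>\<close>, where \<open>g (\<alpha> \<one>) = inv a\<close>, this says that
  \<open>f (a \<otimes> g (\<alpha> u))\<close> is central; so is \<open>a \<otimes> g (\<alpha> u)\<close>, which equals \<open>inv (f u) \<otimes> u\<close> by the
  definition of \<open>\<alpha>\<close>. Once \<open>f\<close> is a central automorphism, \<open>c \<one>\<close> is central and commutation of \<open>f\<close> and
  \<open>g\<close> follows.
\<close>

lemma entropic_iff: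
  "(\<forall>x\<in>carrier G. \<forall>y\<in>carrier G. \<forall>u\<in>carrier G. \<forall>v\<in>carrier G.
      (x \<cdot> y) \<cdot> (right_unit_of u \<cdot> v) = (x \<cdot> right_unit_of u) \<cdot> (y \<cdot> v))
    \<longleftrightarrow> (\<forall>y\<in>carrier G. f (g y) = g (f y)) \<and> moves_by_centre G f"
  (is "?entropic \<longleftrightarrow> ?central")
proof -
  have reduced: "?entropic \<longleftrightarrow> (\<forall>u\<in>carrier G. \<forall>y\<in>carrier G.
      f (g y) \<otimes> a \<otimes> g (f (right_unit_of u)) = f (g (right_unit_of u)) \<otimes> a \<otimes> g (f y))"
    using one_closed by (auto simp: entropic_at_iff)
  show ?thesis
  proof
    assume ?entropic
    then have E: "f (g y) \<otimes> a \<otimes> g (f (right_unit_of u)) = f (g (right_unit_of u)) \<otimes> a \<otimes> g (f y)"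
      if "u \<in> carrier G" "y \<in> carrier G" for u y
      using reduced that by blast
    define c where "c u = f (g (right_unit_of u)) \<otimes> a" for u
    have c_closed [simp]: "c u \<in> carrier G" if "u \<in> carrier G" for u
      using that by (simp add: c_def)
    have swap: "f (g y) \<otimes> c u = c u \<otimes> g (f y)" if u: "u \<in> carrier G" and y: "y \<in> carrier G" for u y
    proof -
      have "a \<otimes> g (f (right_unit_of u)) = c u"
        using E[OF u one_closed] u by (simp add: c_def)
      then show ?thesis using E[OF u y] u y by (simp add: c_def m_assoc)
    qed
    have base: "inv (g (right_unit_of \<one>)) = a"
      using right_unit_equation[of \<one>] by (intro inv_equality) simp_all
    have m_centre: "a \<otimes> g (right_unit_of u) \<in> centre G" if u: "u \<in> carrier G" for u
    proof -
      define m where "m = a \<otimes> g (right_unit_of u)"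
      have m: "m \<in> carrier G" using u by (simp add: m_def)
      define d where "d = inv (c \<one>) \<otimes> c u"
      have d: "d \<in> carrier G" using u by (simp add: d_def)
      have "d \<in> centre G"
      proof (rule centreI[OF d])
        fix q assume q: "q \<in> carrier G"
        obtain y' where y': "y' \<in> carrier G" "g y' = q" using g_onto[OF q] .
        obtain y where y: "y \<in> carrier G" "f y = y'" using f_onto[OF y'(1)] .
        have "inv (c \<one>) \<otimes> f (g y) = q \<otimes> inv (c \<one>)"
        proof -
          have "f (g y) = c \<one> \<otimes> q \<otimes> inv (c \<one>)"
            using inv_solve_right[of "f (g y)" "c \<one> \<otimes> q" "c \<one>"] swap[OF one_closed y(1)] y y' q by simp
          then show ?thesis using q by (simp add: word_simps)
        qed
        moreover have "d \<otimes> q = inv (c \<one>) \<otimes> f (g y) \<otimes> c u"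
          using swap[OF u y(1)] y y' q u by (simp add: d_def m_assoc)
        ultimately show "d \<otimes> q = q \<otimes> d"
          using u q by (simp add: d_def m_assoc)
      qed
      moreover have "f m = a \<otimes> d \<otimes> inv a"
      proof -
        have "m = inv (g (right_unit_of \<one>)) \<otimes> g (right_unit_of u)" by (simp add: m_def base)
        then have "f m = inv (f (g (right_unit_of \<one>))) \<otimes> f (g (right_unit_of u))"
          using u by (simp add: f_mult f_inv)
        then show ?thesis using u by (simp add: d_def c_def word_simps)
      qed
      ultimately have "f m \<in> centre G"
        using centre_commute[of d a, symmetric] d by (simp add: m_assoc)
      then show ?thesis
        using centre_if_automorphic_image_in_centre[OF f_iso m] by (simp add: m_def)
    qed
    have "f u = u \<otimes> inv (a \<otimes> g (right_unit_of u))" if u: "u \<in> carrier G" for u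
      using right_unit_equation[OF u] u by (intro inv_solve_right[THEN iffD2]) simp_all
    then have central: "moves_by_centre G f"
      using m_centre inv_centre unfolding moves_by_centre_def by blast
    have comm: "f (g y) = g (f y)" if y: "y \<in> carrier G" for y
    proof -
      obtain w where w: "w \<in> centre G" "f a = a \<otimes> w"
        using central a unfolding moves_by_centre_def by blast
      have "g (right_unit_of \<one>) = inv a" using base inv_inv[of "g (right_unit_of \<one>)"] by simp
      then have "c \<one> = inv w"
        using centre_closed[OF w(1)] by (simp add: c_def f_inv w(2) word_simps)
      then have "c \<one> \<in> centre G" using inv_centre[OF w(1)] by simp
      then have "f (g y) \<otimes> c \<one> = g (f y) \<otimes> c \<one>"
        using swap[OF one_closed y] centre_commute[of "c \<one>" "g (f y)"] y by simp
      then show ?thesis using y by simp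
    qed
    with central show ?central by simp
  next
    assume ?central
    then have comm: "\<And>y. y \<in> carrier G \<Longrightarrow> f (g y) = g (f y)"
      and central: "\<And>y. y \<in> carrier G \<Longrightarrow> \<exists>z\<in>centre G. f y = y \<otimes> z"
      by (simp_all add: moves_by_centre_def)
    have "f (g y) \<otimes> a \<otimes> g (f e) = f (g e) \<otimes> a \<otimes> g (f y)"
      if u: "u \<in> carrier G" and y: "y \<in> carrier G" and e_def: "e = right_unit_of u" for u y e
    proof -
      have e: "e \<in> carrier G" using u by (simp add: e_def)
      obtain z where z: "z \<in> centre G" "f u = u \<otimes> z" using central[OF u] by auto
      obtain w where w: "w \<in> centre G" "f (g e) = g e \<otimes> w" using central[of "g e"] e by auto
      define t where "t = inv z \<otimes> w"
      have t: "t \<in> centre G" using z w by (simp add: t_def centre_mult inv_centre)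
      note carr = centre_closed[OF z(1)] centre_closed[OF w(1)] centre_closed[OF t]
      have "u \<otimes> (z \<otimes> (a \<otimes> g e)) = u"
        using right_unit_equation[OF u] u e carr by (simp add: e_def[symmetric] z(2) m_assoc)
      then have "z \<otimes> (a \<otimes> g e) = \<one>" using u e carr by simp
      then have "g e = inv a \<otimes> inv z"
        using inv_solve_left[of "a \<otimes> g e" z \<one>] inv_solve_left[of "g e" a "inv z"] e carr by simp
      then have "g e \<otimes> w = inv a \<otimes> t"
        using carr by (simp add: t_def m_assoc)
      then have fge: "f (g e) = inv a \<otimes> t"
        by (simp only: w(2))
      have "a \<otimes> f (g e) = t" "f (g e) \<otimes> a = t"
        using carr centre_commute[OF t a] by (simp_all add: fge word_simps)
      then show ?thesis
        using y e carr centre_commute[OF t, of "f (g y)"] by (simp add: comm[symmetric] m_assoc)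
    qed
    then show ?entropic using reduced by blast
  qed
qed

lemma left_F_iff_entropic:
  "left_F_quasigroup (carrier G) (\<cdot>)
    \<longleftrightarrow> (\<forall>x\<in>carrier G. \<forall>y\<in>carrier G. \<forall>u\<in>carrier G. \<forall>v\<in>carrier G.
      (x \<cdot> y) \<cdot> (right_unit_of u \<cdot> v) = (x \<cdot> right_unit_of u) \<cdot> (y \<cdot> v))"
  by (simp only: left_F_iff entropic_iff)

lemma right_F_iff_entropic:
  "right_F_quasigroup (carrier G) (\<cdot>)
    \<longleftrightarrow> (\<forall>x\<in>carrier G. \<forall>y\<in>carrier G. \<forall>u\<in>carrier G. \<forall>v\<in>carrier G.
      (x \<cdot> y) \<cdot> (left_unit (carrier G) (\<cdot>) u \<cdot> v) = (x \<cdot> left_unit (carrier G) (\<cdot>) u) \<cdot> (y \<cdot> v))"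
proof -
  interpret opp: affine_quasigroup "opposite_group G" "\<lambda>x y. y \<cdot> x" g f a
    by (rule opposite)
  have unit: "right_unit (carrier G) (\<lambda>x y. y \<cdot> x) = left_unit (carrier G) (\<cdot>)"
    by (simp add: right_unit_def left_unit_def fun_eq_iff)
  have "right_F_quasigroup (carrier G) (\<cdot>) \<longleftrightarrow> left_F_quasigroup (carrier G) (\<lambda>x y. y \<cdot> x)"
    unfolding right_F_quasigroup_def left_F_quasigroup_def unit
    using quasigroup_axioms opposite_quasigroup by blast
  also have "\<dots> \<longleftrightarrow> (\<forall>x\<in>carrier G. \<forall>y\<in>carrier G. \<forall>u\<in>carrier G. \<forall>v\<in>carrier G.
      (v \<cdot> left_unit (carrier G) (\<cdot>) u) \<cdot> (y \<cdot> x) = (v \<cdot> y) \<cdot> (left_unit (carrier G) (\<cdot>) u \<cdot> x))"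
    using opp.left_F_iff_entropic by (simp only: opposite_group_simps unit)
  also have "\<dots> \<longleftrightarrow> (\<forall>x\<in>carrier G. \<forall>y\<in>carrier G. \<forall>u\<in>carrier G. \<forall>v\<in>carrier G.
      (x \<cdot> y) \<cdot> (left_unit (carrier G) (\<cdot>) u \<cdot> v) = (x \<cdot> left_unit (carrier G) (\<cdot>) u) \<cdot> (y \<cdot> v))"
    by metis
  finally show ?thesis .
qed

end

section \<open>The characterisation of FG-quasigroups\<close>

text \<open>The two lemmas below feed one instance of each hypothesis into \<open>affine_if_shifts\<close>: any
  \<open>o'\<close> serves as the fixed argument in the F-laws, and in the identity at \<open>e\<close> all fixed arguments
  may be taken to be \<open>e\<close>.\<close>

lemma (in quasigroup) F_quasigroup_affine_over_group:
  assumes "F_quasigroup Q (\<cdot>)" and isotopic: "isotopic_to_group Q (\<cdot>)"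
  shows "\<exists>(G :: 'a monoid) f g a. carrier G = Q \<and> affine_quasigroup G (\<cdot>) f g a"
proof -
  obtain G :: "'a monoid" and A B where G: "carrier G = Q" and "principal_isotope G (\<cdot>) A B"
    using principal_isotope_exists[OF isotopic] by (elim exE conjE)
  then interpret iso: principal_isotope G "(\<cdot>)" A B by simp
  obtain o' where o': "o' \<in> Q" using nonempty by auto
  note units = left_unit(1)[OF o'] right_unit(1)[OF o']
  have "\<exists>f g a. affine_quasigroup G (\<cdot>) f g a"
  proof (rule iso.affine_if_shifts; unfold G)
    show "o' \<cdot> (y \<cdot> z) = (o' \<cdot> y) \<cdot> (right_unit Q (\<cdot>) o' \<cdot> z)" if "y \<in> Q" "z \<in> Q" for y z
      using assms(1) o' that by (simp add: F_quasigroup_def left_F_quasigroup_def)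
    show "(z \<cdot> y) \<cdot> o' = (z \<cdot> left_unit Q (\<cdot>) o') \<cdot> (y \<cdot> o')" if "y \<in> Q" "z \<in> Q" for y z
      using assms(1) o' that by (simp add: F_quasigroup_def right_F_quasigroup_def)
  qed (simp_all add: o' units mult_closed)
  with G show ?thesis by blast
qed

lemma (in quasigroup) entropic_at_affine_over_group:
  assumes e: "e \<in> Q"
    and entropic: "\<forall>x\<in>Q. \<forall>y\<in>Q. \<forall>v\<in>Q. (x \<cdot> y) \<cdot> (e \<cdot> v) = (x \<cdot> e) \<cdot> (y \<cdot> v)"
  shows "\<exists>(G :: 'a monoid) f g a. carrier G = Q \<and> affine_quasigroup G (\<cdot>) f g a"
proof -
  obtain G :: "'a monoid" and A B where G: "carrier G = Q" and "principal_isotope G (\<cdot>) A B"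
    using principal_isotope_exists[OF isotopic_to_group_if_entropic_at[OF e entropic]]
    by (elim exE conjE)
  then interpret iso: principal_isotope G "(\<cdot>)" A B by simp
  have "\<exists>f g a. affine_quasigroup G (\<cdot>) f g a"
  proof (rule iso.affine_if_shifts; unfold G)
    show "(e \<cdot> e) \<cdot> (y \<cdot> z) = (e \<cdot> y) \<cdot> (e \<cdot> z)" if "y \<in> Q" "z \<in> Q" for y z
      using entropic e that by simp
    show "(z \<cdot> y) \<cdot> (e \<cdot> e) = (z \<cdot> e) \<cdot> (y \<cdot> e)" if "y \<in> Q" "z \<in> Q" for y z
      using entropic e that by simp
  qed (simp_all add: e mult_closed)
  with G show ?thesis by blast
qed

theorem theorem2p8:
  fixes Q :: "'a set" and mult :: "'a \<Rightarrow> 'a \<Rightarrow> 'a" (infixl "\<cdot>" 70)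
    and \<alpha> \<beta> :: "'a \<Rightarrow> 'a"
  defines "\<alpha> \<equiv> right_unit Q (\<cdot>)" and "\<beta> \<equiv> left_unit Q (\<cdot>)"
  assumes "quasigroup Q (\<cdot>)"
  shows "FG_quasigroup Q (\<cdot>) \<longleftrightarrow>
    (\<forall>x\<in>Q. \<forall>y\<in>Q. \<forall>u\<in>Q. \<forall>v\<in>Q. (x \<cdot> y) \<cdot> (\<alpha> u \<cdot> v) = (x \<cdot> \<alpha> u) \<cdot> (y \<cdot> v)) \<and>
    (\<forall>x\<in>Q. \<forall>y\<in>Q. \<forall>u\<in>Q. \<forall>v\<in>Q. (x \<cdot> y) \<cdot> (\<beta> u \<cdot> v) = (x \<cdot> \<beta> u) \<cdot> (y \<cdot> v))"
    (is "_ \<longleftrightarrow> ?A \<and> ?B")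
proof -
  interpret quasigroup Q "(\<cdot>)" by fact
  have F_iff: "F_quasigroup Q (\<cdot>) \<longleftrightarrow> ?A \<and> ?B"
    if affine: "\<exists>(G :: 'a monoid) f g a. carrier G = Q \<and> affine_quasigroup G (\<cdot>) f g a"
  proof -
    obtain G :: "'a monoid" and f g a where G: "carrier G = Q" and "affine_quasigroup G (\<cdot>) f g a"
      using affine by (elim exE conjE)
    then interpret affine: affine_quasigroup G "(\<cdot>)" f g a by simp
    show ?thesis
      unfolding F_quasigroup_def \<alpha>_def \<beta>_def
      using affine.left_F_iff_entropic affine.right_F_iff_entropic by (simp only: G)
  qed
  show ?thesis
  proof
    assume "FG_quasigroup Q (\<cdot>)"
    then have F: "F_quasigroup Q (\<cdot>)" and isotopic: "isotopic_to_group Q (\<cdot>)"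
      by (simp_all add: FG_quasigroup_def)
    from F show "?A \<and> ?B"
      using F_iff[OF F_quasigroup_affine_over_group[OF F isotopic]] by simp
  next
    assume AB: "?A \<and> ?B"
    obtain u where u: "u \<in> Q" using nonempty by auto
    have \<alpha>u: "\<alpha> u \<in> Q" using right_unit(1)[OF u] by (simp add: \<alpha>_def)
    have entropic: "\<forall>x\<in>Q. \<forall>y\<in>Q. \<forall>v\<in>Q. (x \<cdot> y) \<cdot> (\<alpha> u \<cdot> v) = (x \<cdot> \<alpha> u) \<cdot> (y \<cdot> v)"
      using AB u by blast
    have "F_quasigroup Q (\<cdot>)"
      using F_iff[OF entropic_at_affine_over_group[OF \<alpha>u entropic]] AB by simp
    then show "FG_quasigroup Q (\<cdot>)"
      using isotopic_to_group_if_entropic_at[OF \<alpha>u entropic] by (simp add: FG_quasigroup_def)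
  qed
qed

end
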